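(* Let $\mathbb{F}_q$ be a finite field of odd characteristic with $q\equiv 1\pmod 6$, let $T$ be a generator of the group of multiplicative characters of $\mathbb{F}_q$, and let $a,b,c\in\mathbb{F}_q^\times$ be all distinct. If $h\in\mathbb{F}_q^\times$ satisfies $$3h^2+2\,\frac{ab+bc+ca}{bc}\,h+\frac{ab+ca+a^2}{bc}=0,$$ then $$\varphi_{(1,1,1)}(a,b,c)=-1+q\,\varphi(bc)\,\varphi(-3f)\;{_2}F_1\left(\begin{array}{cc}T^{\frac{q-1}{6}},&T^{\frac{5(q-1)}{6}}\\ &\varepsilon\end{array}\Big|\ -\frac{3^3g}{2^2f^3}\right),$$ where $$f=3h+\frac{ab+bc+ca}{bc},\qquad g=h^3+\frac{ab+bc+ca}{bc}h^2+\frac{ab+ca+a^2}{bc}h+\frac{a^2}{bc}.$$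
   Context: Multiplicative characters $\chi:\mathbb{F}_q^\times\to\mathbb{C}^\times$ are extended to $\mathbb{F}_q$ by $\chi(0):=0$, including the trivial character $\varepsilon$; $\overline{\chi}$ is the inverse of $\chi$. $\varphi$ is the quadratic character and $\varepsilon$ the trivial character of $\mathbb{F}_q$. $\varphi_{(1,1,1)}(a,b,c):=\sum_{x\in\mathbb{F}_q}\varphi(x)\varphi(x+a)\varphi(x+b)\varphi(x+c)$. For characters $A,B,C$ and $x\in\mathbb{F}_q$, Greene's finite field hypergeometric series is $${_2}F_1\left(\begin{array}{cc}A,&B\\ &C\end{array}\Big|\ x\right):=\varepsilon(x)\frac{BC(-1)}{q}\sum_{y\in\mathbb{F}_q}B(y)\,\overline{B}C(1-y)\,\overline{A}(1-xy).$$
   Formalization: The formal theorem adds the assumption f ≠ 0, without which the argument −3³g/(2²f³) is undefined; f = 0 does occur under the stated hypotheses (e.g. q = 7, a/b = 2, a/c = −1, h = 4). *)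

theory Defs
  imports
    Complex_Main
    "HOL-Library.Cardinality"
    "HOL-Computational_Algebra.Primes"
    "HOL-Number_Theory.Cong"
    "HOL-Algebra.Generated_Groups"
begin

text \<open>
  The finite field with \<open>q\<close> elements is a type \<^typ>\<open>'a\<close> of class \<open>finite_field\<close>,
  with \<open>q = CARD('a)\<close>. Every multiplicative character, the trivial one included, is a function on
  the whole field that takes the value \<open>0\<close> at \<open>0\<close>.
\<close>

definition trivial_char :: "'a :: finite_field \<Rightarrow> complex" where
  "trivial_char x = (if x = 0 then 0 else 1)"

definition quadratic_char :: "'a :: finite_field \<Rightarrow> complex" where
  "quadratic_char x = (if x = 0 then 0 else if \<exists>y. x = y ^ 2 then 1 else - 1)"

definition char_group :: "('a :: finite_field \<Rightarrow> complex) monoid" where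
  "char_group =
    \<lparr>carrier = {\<chi>. \<chi> 0 = 0 \<and> (\<forall>x. x \<noteq> 0 \<longrightarrow> \<chi> x \<noteq> 0) \<and>
                  (\<forall>x y. x \<noteq> 0 \<longrightarrow> y \<noteq> 0 \<longrightarrow> \<chi> (x * y) = \<chi> x * \<chi> y)},
     mult = (\<lambda>\<chi> \<psi> x. \<chi> x * \<psi> x),
     one = trivial_char\<rparr>"

lemma inverse_in_char_group:
  "\<chi> \<in> carrier char_group \<Longrightarrow> (\<lambda>x. inverse (\<chi> x)) \<in> carrier char_group"
  by (auto simp: char_group_def)

lemma inverse_mult_char_group:
  "\<chi> \<in> carrier char_group \<Longrightarrow>
    (\<lambda>x. inverse (\<chi> x)) \<otimes>\<^bsub>char_group\<^esub> \<chi> = \<one>\<^bsub>char_group\<^esub>"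
  by (auto simp: char_group_def trivial_char_def fun_eq_iff)

lemma comm_group_char_group: "comm_group (char_group :: ('a :: finite_field \<Rightarrow> complex) monoid)"
proof (rule comm_groupI)
  fix \<chi> :: "'a \<Rightarrow> complex"
  assume "\<chi> \<in> carrier char_group"
  then show "\<exists>\<psi>\<in>carrier char_group. \<psi> \<otimes>\<^bsub>char_group\<^esub> \<chi> = \<one>\<^bsub>char_group\<^esub>"
    using inverse_in_char_group inverse_mult_char_group by blast
qed (auto simp: char_group_def trivial_char_def fun_eq_iff)

lemma inv_char_group:
  fixes \<chi> :: "'a :: finite_field \<Rightarrow> complex"
  assumes "\<chi> \<in> carrier char_group"
  shows "inv\<^bsub>char_group\<^esub> \<chi> = (\<lambda>x. inverse (\<chi> x))"
proof -
  interpret comm_group "char_group :: ('a \<Rightarrow> complex) monoid"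
    by (rule comm_group_char_group)
  show ?thesis
    using assms inverse_in_char_group inverse_mult_char_group by (metis inv_equality)
qed

definition phi111 :: "'a :: finite_field \<Rightarrow> 'a \<Rightarrow> 'a \<Rightarrow> complex" where
  "phi111 a b c =
    (\<Sum>x\<in>UNIV. quadratic_char x * quadratic_char (x + a) * quadratic_char (x + b) *
      quadratic_char (x + c))"

text \<open>Greene's series with upper characters \<open>A\<close>, \<open>B\<close>, lower character \<open>C\<close> and argument \<open>x\<close>.\<close>

definition greene_2F1 ::
  "('a :: finite_field \<Rightarrow> complex) \<Rightarrow> ('a \<Rightarrow> complex) \<Rightarrow> ('a \<Rightarrow> complex) \<Rightarrow> 'a \<Rightarrow> complex" where
  "greene_2F1 A B C x =
    trivial_char x * ((B \<otimes>\<^bsub>char_group\<^esub> C) (- 1) / of_nat CARD('a)) *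
    (\<Sum>y\<in>UNIV. B y * (inv\<^bsub>char_group\<^esub> B \<otimes>\<^bsub>char_group\<^esub> C) (1 - y) *
      (inv\<^bsub>char_group\<^esub> A) (1 - x * y))"

end

theory Submission
  imports Defs "HOL-Algebra.Multiplicative_Group"
begin

text \<open>
  The substitution \<open>x = a / y\<close>, a shift by \<open>h\<close> and a scaling turn the quartic sum into
  \<open>\<Sum>w. \<phi>(w\<^sup>3 - 3 w + k)\<close> with \<open>k = 2 - 4 x\<close>, where now \<open>x\<close> is the argument of the series. For a cubic
  character \<open>\<rho>\<close> and any function \<open>F\<close> one has
  \<open>\<Sum>w. F(w\<^sup>3 - 3 w) = (\<Sum>t\<noteq>0. \<rho>(t) F(t + 1 / t)) + (\<Sum>u. F(u))\<close>: if \<open>w = s + 1 / s\<close> then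
  \<open>w\<^sup>3 - 3 w = s\<^sup>3 + 1 / s\<^sup>3\<close>, and on the remaining \<open>w\<close> the map \<open>w \<mapsto> w\<^sup>3 - 3 w\<close> is a permutation.
  On the other side, Greene's sum runs over \<open>\<chi>(t)\<close> with \<open>\<chi> = \<phi> \<rho>\<close> of order six and
  \<open>t = y (1 - x y) / (1 - y)\<close>; this is a quadratic equation for \<open>y\<close> with discriminant
  \<open>(1 + t)\<^sup>2 - 4 x t = t (t + 1 / t + k)\<close>, so the two sums agree for \<open>F(u) = \<phi>(u + k)\<close>.
\<close>

subsection \<open>Multiplicative characters\<close>

definition mult_generator :: "'a :: finite_field \<Rightarrow> bool" where
  "mult_generator z \<longleftrightarrow> z \<noteq> 0 \<and> (\<forall>x. x \<noteq> 0 \<longrightarrow> (\<exists>i. x = z ^ i))"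

lemma mult_generatorE:
  assumes "mult_generator z" and "x \<noteq> 0"
  obtains i where "x = z ^ i"
  using assms by (auto simp: mult_generator_def)

text \<open>Finite subgroups of the unit group of a field are cyclic. The type class operations are
  packed into a ring record \<open>R\<close> so that the HOL-Algebra form of this fact applies, and
  its powers are then identified with those of the type.\<close>

lemma mult_generator_exists: "\<exists>z :: 'a :: finite_field. mult_generator z"
proof -
  define R :: "'a ring" where
    "R = \<lparr>carrier = UNIV, mult = (*), one = 1, zero = 0, add = (+)\<rparr>"
  have "cring R"
    by (intro cringI abelian_groupI comm_monoidI)
       (auto simp: R_def algebra_simps intro: exI[of _ "- x" for x])
  then have "field R"
  proof (rule cring.cring_fieldI2)
    fix x assume "x \<in> carrier R" "x \<noteq> \<zero>\<^bsub>R\<^esub>"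
    then show "\<exists>y\<in>carrier R. x \<otimes>\<^bsub>R\<^esub> y = \<one>\<^bsub>R\<^esub>"
      by (intro bexI[of _ "inverse x"]) (auto simp: R_def)
  qed (auto simp: R_def)
  moreover have "finite (carrier R)"
    by (simp add: R_def)
  ultimately obtain z where z: "z \<in> carrier (mult_of R)"
    "carrier (mult_of R) = {z [^]\<^bsub>R\<^esub> i | i :: nat. i \<in> UNIV}"
    using field.finite_field_mult_group_has_gen by blast
  have pow: "z [^]\<^bsub>R\<^esub> i = z ^ i" for i :: nat
    by (induction i) (simp_all add: R_def nat_pow_def mult.commute)
  have "z \<noteq> 0" and "UNIV - {0} = {x. \<exists>i. x = z ^ i}"
    using z unfolding pow by (auto simp: R_def)
  then have "mult_generator z"
    unfolding mult_generator_def by blast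
  then show ?thesis ..
qed

lemma power_card_minus_1:
  fixes x :: "'a :: finite_field"
  assumes "x \<noteq> 0"
  shows "x ^ (CARD('a) - 1) = 1"
proof -
  have "x * x ^ (CARD('a) - 1) = x * 1"
    using finite_field_power_card_eq_same[of x] zero_less_card_finite[where 'a = 'a]
    by (simp flip: power_Suc)
  then show ?thesis
    using assms by simp
qed

text \<open>If \<open>i\<close> left a nonzero remainder \<open>m\<close> modulo
  \<open>q - 1\<close>, then \<open>z ^ m = 1\<close>, and the powers with exponent below
  \<open>m\<close> would already exhaust all \<open>q - 1\<close> nonzero elements.\<close>

lemma mult_generator_power_eq_1_iff:
  fixes z :: "'a :: finite_field"
  assumes z: "mult_generator z"
  shows "z ^ i = 1 \<longleftrightarrow> CARD('a) - 1 dvd i"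
proof
  let ?n = "CARD('a) - 1"
  have z0: "z \<noteq> 0"
    using z by (simp add: mult_generator_def)
  have zn: "z ^ ?n = 1"
    by (rule power_card_minus_1) (rule z0)
  show "z ^ i = 1" if "?n dvd i"
    using that zn by (auto simp: power_mult)
  have n0: "?n > 0"
    using card_mono[of UNIV "{0, 1 :: 'a}"] by simp
  assume "z ^ i = 1"
  moreover have "z ^ (?n * (i div ?n)) = 1"
    by (simp only: power_mult zn power_one)
  moreover have "z ^ i = z ^ (?n * (i div ?n)) * z ^ (i mod ?n)"
    by (subst power_add [symmetric]) simp
  ultimately have zm: "z ^ (i mod ?n) = 1"
    by simp
  show "?n dvd i"
  proof (rule ccontr)
    assume "\<not> ?n dvd i"
    then have m: "i mod ?n > 0"
      by (simp add: mod_greater_zero_iff_not_dvd)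
    define m where "m = i mod ?n"
    have "UNIV - {0} \<subseteq> (\<lambda>j. z ^ j) ` {..<m}"
    proof
      fix x :: 'a assume "x \<in> UNIV - {0}"
      then obtain j where j: "x = z ^ j"
        using mult_generatorE[OF z, of x] by auto
      have "z ^ j = z ^ (m * (j div m)) * z ^ (j mod m)"
        by (subst power_add [symmetric]) simp
      then have "z ^ j = z ^ (j mod m)"
        using zm by (simp add: power_mult m_def)
      then show "x \<in> (\<lambda>j. z ^ j) ` {..<m}"
        using j m by (auto simp: m_def)
    qed
    then have "card (UNIV - {0 :: 'a}) \<le> card ((\<lambda>j. z ^ j) ` {..<m})"
      by (intro card_mono) auto
    also have "\<dots> \<le> m"
      using card_image_le[of "{..<m}" "\<lambda>j. z ^ j"] by simp
    finally have "?n \<le> m"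
      by (simp add: card_Diff_singleton)
    moreover have "m < ?n"
      unfolding m_def by (rule mod_less_divisor) (rule n0)
    ultimately show False
      by linarith
  qed
qed

text \<open>Write \<open>- 1 = z ^ i\<close>. Then \<open>q - 1\<close> divides
  \<open>2 * i\<close>; if it were odd it would divide \<open>i\<close>, forcing
  \<open>- 1 = 1\<close>.\<close>

lemma even_card_minus_1:
  assumes "(2 :: 'a :: finite_field) \<noteq> 0"
  shows "even (CARD('a) - 1)"
proof (rule ccontr)
  assume "odd (CARD('a) - 1)"
  moreover obtain z :: 'a where z: "mult_generator z"
    using mult_generator_exists by blast
  obtain i where i: "- 1 = z ^ i"
    using mult_generatorE[OF z, of "- 1"] by auto
  have "z ^ (2 * i) = 1"
    by (metis i power2_minus power_mult mult.commute one_power2)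
  ultimately have "z ^ i = 1"
    by (simp add: mult_generator_power_eq_1_iff[OF z] coprime_dvd_mult_right_iff)
  then have "(2 :: 'a) = 0"
    using i by (metis add.right_inverse one_add_one)
  then show False
    using assms by simp
qed

text \<open>The exponent is determined modulo the even number \<open>q - 1\<close>, so its parity is
  well defined and the nonzero squares are exactly the even powers of \<open>z\<close>.\<close>

lemma quadratic_char_generator_power:
  fixes z :: "'a :: finite_field"
  assumes z: "mult_generator z" and two: "(2 :: 'a) \<noteq> 0"
  shows "quadratic_char (z ^ i) = (- 1) ^ i"
proof -
  have z0: "z \<noteq> 0"
    using z by (simp add: mult_generator_def)
  have "even i" if y: "z ^ i = y ^ 2" for y
  proof -
    have "y \<noteq> 0"
      using y z0 by auto
    then obtain j where "y = z ^ j"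
      using mult_generatorE[OF z] by blast
    then have "z ^ i = z ^ (2 * j)"
      using y by (simp add: power_mult mult.commute)
    \<comment> \<open>Stated for \<open>k + m\<close> because either of the exponents
      \<open>i\<close> and \<open>2 * j\<close> may be the larger one.\<close>
    moreover have "even m" if "z ^ (k + m) = z ^ k" for k m
    proof -
      have "z ^ m = 1"
        using that z0 by (simp add: power_add)
      then show ?thesis
        using mult_generator_power_eq_1_iff[OF z] even_card_minus_1[OF two] dvd_trans by blast
    qed
    ultimately show ?thesis
      by (metis dvd_triv_left even_add le_add_diff_inverse linear)
  qed
  moreover have "\<exists>y. z ^ i = y ^ 2" if "even i"
    using that by (metis dvdE mult.commute power_mult)
  ultimately have "(\<exists>y. z ^ i = y ^ 2) \<longleftrightarrow> even i"
    by blast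
  then show ?thesis
    using z0 by (simp add: quadratic_char_def)
qed

lemma quadratic_char_mult:
  fixes x y :: "'a :: finite_field"
  assumes two: "(2 :: 'a) \<noteq> 0"
  shows "quadratic_char (x * y) = quadratic_char x * quadratic_char y"
proof (cases "x = 0 \<or> y = 0")
  case True
  then show ?thesis
    by (auto simp: quadratic_char_def)
next
  case False
  obtain z :: 'a where z: "mult_generator z"
    using mult_generator_exists by blast
  obtain i j where "x = z ^ i" "y = z ^ j"
    using False mult_generatorE[OF z] by metis
  then show ?thesis
    using quadratic_char_generator_power[OF z two] by (simp flip: power_add)
qed

lemma quadratic_char_0 [simp]: "quadratic_char 0 = 0"
  by (simp add: quadratic_char_def)

lemma quadratic_char_square [simp]: "y \<noteq> 0 \<Longrightarrow> quadratic_char (y ^ 2) = 1"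
  by (auto simp: quadratic_char_def)

lemma quadratic_char_squared: "x \<noteq> 0 \<Longrightarrow> quadratic_char x * quadratic_char x = 1"
  by (auto simp: quadratic_char_def)

lemma quadratic_char_square_mult:
  fixes x y :: "'a :: finite_field"
  assumes "(2 :: 'a) \<noteq> 0" and "y \<noteq> 0"
  shows "quadratic_char (y ^ 2 * x) = quadratic_char x"
  using assms by (simp add: quadratic_char_mult)

lemma char_mult:
  "\<chi> \<in> carrier char_group \<Longrightarrow> \<chi> (x * y) = \<chi> x * \<chi> y"
  by (cases "x = 0"; cases "y = 0") (auto simp: char_group_def)

lemma char_0: "\<chi> \<in> carrier char_group \<Longrightarrow> \<chi> 0 = 0"
  by (simp add: char_group_def)

lemma char_nonzero: "\<chi> \<in> carrier char_group \<Longrightarrow> x \<noteq> 0 \<Longrightarrow> \<chi> x \<noteq> 0"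
  by (simp add: char_group_def)

lemma char_1: "\<chi> \<in> carrier char_group \<Longrightarrow> \<chi> 1 = 1"
  using char_mult[of \<chi> 1 1] char_nonzero[of \<chi> 1] by simp

lemma char_power: "\<chi> \<in> carrier char_group \<Longrightarrow> \<chi> (x ^ i) = \<chi> x ^ i"
  by (induction i) (simp_all add: char_1 char_mult)

lemma char_inverse:
  assumes "\<chi> \<in> carrier char_group"
  shows "\<chi> (inverse x) = inverse (\<chi> x)"
proof (cases "x = 0")
  case False
  then have "\<chi> x * \<chi> (inverse x) = 1"
    using assms by (simp add: char_1 flip: char_mult)
  then show ?thesis
    by (simp add: inverse_unique)
qed (simp add: assms char_0)

text \<open>The excluded case is \<open>n = 0\<close> at \<open>x = 0\<close>, where the trivial
  character gives \<open>0\<close> while \<open>0 ^ 0 = 1\<close>.\<close>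

lemma char_group_pow_apply:
  assumes "\<chi> \<in> carrier char_group" and "n > 0 \<or> x \<noteq> 0"
  shows "(\<chi> [^]\<^bsub>char_group\<^esub> (n :: nat)) x = \<chi> x ^ n"
proof (cases "x = 0")
  case False
  then show ?thesis
    by (induction n) (simp_all add: nat_pow_def char_group_def trivial_char_def mult.commute)
next
  case True
  then obtain m where "n = Suc m"
    using assms gr0_conv_Suc by blast
  with True assms show ?thesis
    by (simp add: nat_pow_def char_group_def)
qed

lemma char_group_pow_closed:
  "\<chi> \<in> carrier char_group \<Longrightarrow> \<chi> [^]\<^bsub>char_group\<^esub> (n :: nat) \<in> carrier char_group"
  using comm_group_char_group by (intro monoid.nat_pow_closed) (auto simp: comm_group_def comm_monoid_def)

text \<open>Multiplication by \<open>z\<close> permutes the field and scales the sum by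
  \<open>\<chi> z\<close>, which differs from \<open>1\<close>.\<close>

lemma sum_char_nontrivial:
  fixes \<chi> :: "'a :: finite_field \<Rightarrow> complex"
  assumes \<chi>: "\<chi> \<in> carrier char_group" and z: "z \<noteq> 0" "\<chi> z \<noteq> 1"
  shows "(\<Sum>x\<in>UNIV. \<chi> x) = 0"
proof -
  have "(\<Sum>x\<in>UNIV. \<chi> x) = (\<Sum>x\<in>UNIV. \<chi> (z * x))"
    by (rule sum.reindex_bij_witness[of _ "\<lambda>x. z * x" "\<lambda>x. x / z"]) (use z in auto)
  also have "\<dots> = \<chi> z * (\<Sum>x\<in>UNIV. \<chi> x)"
    by (simp add: char_mult[OF \<chi>] sum_distrib_left)
  finally have "(1 - \<chi> z) * (\<Sum>x\<in>UNIV. \<chi> x) = 0"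
    by (simp add: algebra_simps)
  then show ?thesis
    using z by simp
qed

lemma quadratic_char_in_char_group:
  assumes "(2 :: 'a :: finite_field) \<noteq> 0"
  shows "(quadratic_char :: 'a \<Rightarrow> complex) \<in> carrier char_group"
  using quadratic_char_mult[OF assms] by (simp add: char_group_def) (simp add: quadratic_char_def)

lemma sum_quadratic_char:
  assumes "(2 :: 'a :: finite_field) \<noteq> 0"
  shows "(\<Sum>x\<in>UNIV. quadratic_char (x :: 'a)) = 0"
proof -
  obtain z :: 'a where z: "mult_generator z"
    using mult_generator_exists by blast
  have "quadratic_char z = - 1"
    using quadratic_char_generator_power[OF z assms, of 1] by simp
  then show ?thesis
    using z by (intro sum_char_nontrivial[of _ z] quadratic_char_in_char_group assms)
      (auto simp: mult_generator_def)
qed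

text \<open>The character with \<open>z \<mapsto> exp (2\<pi>i / (q - 1))\<close> witnesses that \<open>T z\<close> has exact order \<open>q - 1\<close>.\<close>

lemma char_generator_power_eq_1:
  fixes T :: "'a :: finite_field \<Rightarrow> complex"
  assumes T: "T \<in> carrier char_group" "generate char_group {T} = carrier char_group"
    and z: "mult_generator z" and m: "T z ^ m = 1"
  shows "CARD('a) - 1 dvd m"
proof -
  let ?n = "CARD('a) - 1"
  have z0: "z \<noteq> 0"
    using z by (simp add: mult_generator_def)
  have n0: "?n > 0"
    using card_mono[of UNIV "{0, 1 :: 'a}"] by simp
  define u where "u = cis (2 * pi / ?n)"
  have un: "u ^ ?n = 1"
    using n0 by (simp add: u_def DeMoivre)
  define L where "L x = (SOME i. x = z ^ i)" for x
  have L: "x = z ^ L x" if "x \<noteq> 0" for x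
    using mult_generatorE[OF z that] unfolding L_def by (metis (mono_tags) someI_ex)
  \<comment> \<open>\<open>L\<close> picks an arbitrary discrete logarithm, so
    \<open>u ^ L x\<close> must be shown not to depend on the choice: exponents of equal powers of
    \<open>z\<close> differ by a multiple of \<open>q - 1\<close>, and
    \<open>u ^ (q - 1) = 1\<close>.\<close>
  have u_cong: "u ^ i = u ^ j" if "z ^ i = z ^ j" for i j
    using that
  proof (induction i j rule: linorder_wlog)
    case (le i j)
    then have "z ^ i * z ^ (j - i) = z ^ i * 1"
      by (metis le_add_diff_inverse mult_1_right power_add)
    then have "?n dvd j - i"
      using z0 mult_generator_power_eq_1_iff[OF z] by simp
    then have "u ^ (j - i) = 1"
      using un by (auto elim!: dvdE simp: power_mult)
    then have "u ^ j = u ^ i * 1"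
      using le by (metis le_add_diff_inverse power_add)
    then show ?case
      by simp
  qed (simp add: eq_commute)
  define \<psi> where "\<psi> x = (if x = 0 then 0 else u ^ L x)" for x
  have "\<psi> (x * y) = \<psi> x * \<psi> y" if "x \<noteq> 0" "y \<noteq> 0" for x y
    using that L[of x] L[of y] L[of "x * y"]
    by (simp add: \<psi>_def flip: power_add) (metis u_cong power_add)
  then have "\<psi> \<in> carrier char_group"
    using un n0 by (auto simp: char_group_def \<psi>_def u_def)
  then have "\<psi> \<in> generate char_group {T}"
    using T by simp
  \<comment> \<open>Having \<open>m\<close>-th power \<open>1\<close> at \<open>z\<close> passes
    from \<open>T\<close> to inverses and products, hence to every character that \<open>T\<close>
    generates.\<close>
  then have "\<psi> z ^ m = 1"
  proof (induction rule: generate.induct)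
    case (inv \<chi>)
    then show ?case
      using m T by (simp add: inv_char_group power_inverse)
  next
    case (eng \<chi>1 \<chi>2)
    then show ?case
      by (simp add: char_group_def power_mult_distrib)
  qed (use m z0 in \<open>auto simp: char_group_def trivial_char_def\<close>)
  moreover have "\<psi> z = u"
    using z0 u_cong[of "L z" 1] L[of z] by (simp add: \<psi>_def)
  ultimately have "cis (2 * pi * m / ?n) = 1"
    by (simp add: u_def DeMoivre mult.commute)
  then have "cos (2 * pi * m / ?n) = 1"
    by (simp add: complex_eq_iff)
  then obtain k :: int where "2 * pi * m / ?n = of_int k * 2 * pi"
    using cos_one_2pi_int by auto
  then have "real m = k * real ?n"
    using n0 by (simp add: field_simps del: of_nat_diff of_nat_1 One_nat_def)
  then have "int m = k * int ?n"
    by (metis of_int_eq_iff of_int_mult of_int_of_nat_eq)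
  then show ?thesis
    by (metis dvd_triv_right int_dvd_int_iff)
qed

subsection \<open>Character sums\<close>

lemma sum_comp_card:
  fixes G :: "'b :: finite \<Rightarrow> complex"
  assumes "finite A"
  shows "(\<Sum>x\<in>A. G (f x)) = (\<Sum>y\<in>UNIV. of_nat (card {x \<in> A. f x = y}) * G y)"
proof -
  have "(\<Sum>x\<in>A. G (f x)) = (\<Sum>y\<in>UNIV. \<Sum>x\<in>{x \<in> A. f x = y}. G (f x))"
    using assms by (intro sum.group [symmetric]) auto
  also have "\<dots> = (\<Sum>y\<in>UNIV. of_nat (card {x \<in> A. f x = y}) * G y)"
    by (intro sum.cong refl) simp
  finally show ?thesis .
qed

lemma card_square_roots:
  fixes d :: "'a :: finite_field"
  assumes "(2 :: 'a) \<noteq> 0"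
  shows "of_nat (card {r. r ^ 2 = d}) = 1 + quadratic_char d"
proof -
  consider "d = 0" | "d \<noteq> 0" "\<nexists>r. d = r ^ 2" | s where "s \<noteq> 0" "d = s ^ 2"
    by fastforce
  then show ?thesis
  proof cases
    case 2
    then have "{r. r ^ 2 = d} = {}"
      by auto
    then show ?thesis
      using 2 by (simp add: quadratic_char_def)
  next
    case 3
    have "s \<noteq> - s"
      using 3 assms by (simp add: eq_neg_iff_add_eq_0 flip: mult_2)
    moreover have "{r. r ^ 2 = d} = {s, - s}"
      using 3 by (auto simp: power2_eq_iff)
    ultimately show ?thesis
      using 3 by simp
  qed simp
qed

text \<open>Completing the square: after multiplication by \<open>4 * a\<close> the roots
  correspond, via \<open>y \<mapsto> 2 * a * y + b\<close>, to the square roots of the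
  discriminant.\<close>

lemma card_quadratic_roots:
  fixes a b c :: "'a :: finite_field"
  assumes two: "(2 :: 'a) \<noteq> 0" and a: "a \<noteq> 0"
  shows "of_nat (card {y. a * y ^ 2 + b * y + c = 0}) = 1 + quadratic_char (b ^ 2 - 4 * a * c)"
proof -
  have four: "(4 :: 'a) \<noteq> 0"
    using two by (metis mult_eq_0_iff numeral_Bit0 mult_2)
  have "(2 * a * y + b) ^ 2 - (b ^ 2 - 4 * a * c) = 4 * a * (a * y ^ 2 + b * y + c)" for y
    by Groebner_Basis.algebra
  then have iff: "a * y ^ 2 + b * y + c = 0 \<longleftrightarrow> (2 * a * y + b) ^ 2 = b ^ 2 - 4 * a * c" for y
    using a four by (metis eq_iff_diff_eq_0 mult_eq_0_iff)
  have "bij_betw (\<lambda>y. 2 * a * y + b) {y. a * y ^ 2 + b * y + c = 0} {r. r ^ 2 = b ^ 2 - 4 * a * c}"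
    by (rule bij_betw_byWitness[of _ "\<lambda>r. (r - b) / (2 * a)"]) (use two a in \<open>auto simp: iff\<close>)
  then show ?thesis
    using card_square_roots[OF two] by (simp add: bij_betw_same_card)
qed

text \<open>The fibre of \<open>s + 1 / s\<close> over \<open>w\<close> is the root set of
  \<open>s ^ 2 - w * s + 1\<close>, whose discriminant is \<open>w ^ 2 - 4\<close> and which never
  has the root \<open>0\<close>.\<close>

lemma sum_add_inverse:
  fixes G :: "'a :: finite_field \<Rightarrow> complex"
  assumes two: "(2 :: 'a) \<noteq> 0"
  shows "(\<Sum>s\<in>-{0}. G (s + 1 / s)) = (\<Sum>w\<in>UNIV. (1 + quadratic_char (w ^ 2 - 4)) * G w)"
proof -
  have "{s \<in> -{0}. s + 1 / s = w} = {s. 1 * s ^ 2 + (- w) * s + 1 = 0}" for w :: 'a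
  proof -
    have "s + 1 / s = w \<longleftrightarrow> 1 * s ^ 2 + (- w) * s + 1 = 0" if "s \<noteq> 0" for s
      using that by (auto simp: field_simps power2_eq_square)
    moreover have "s \<noteq> 0" if "1 * s ^ 2 + (- w) * s + 1 = 0" for s
      using that by auto
    ultimately show ?thesis
      by blast
  qed
  then have "of_nat (card {s \<in> -{0}. s + 1 / s = w}) = 1 + quadratic_char (w ^ 2 - 4)" for w :: 'a
    using card_quadratic_roots[OF two, of 1 "- w" 1] by simp
  then show ?thesis
    by (subst sum_comp_card) simp_all
qed

section \<open>Cubic characters and the map \<open>w \<mapsto> w ^ 3 - 3 * w\<close>\<close>

lemma cubic_char_cube:
  fixes \<rho> :: "'a :: finite_field \<Rightarrow> complex"
  assumes \<rho>: "\<rho> \<in> carrier char_group" and z: "mult_generator z" and \<rho>z: "\<rho> z ^ 3 = 1"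
    and t: "t \<noteq> 0"
  shows "\<rho> t ^ 3 = 1"
proof -
  obtain i where "t = z ^ i"
    using mult_generatorE[OF z t] .
  then have "\<rho> t ^ 3 = (\<rho> z ^ 3) ^ i"
    by (simp add: char_power[OF \<rho>] mult.commute flip: power_mult)
  then show ?thesis
    by (simp add: \<rho>z)
qed

text \<open>If \<open>t = r ^ 3\<close>, the three roots are \<open>r\<close> times the cube roots
  of unity and \<open>\<rho> t = 1\<close>. Otherwise \<open>t\<close> is a power of
  \<open>z\<close> with exponent prime to 3, so \<open>\<rho> t\<close> is a primitive cube root of
  unity and the right-hand side vanishes.\<close>

lemma card_cube_roots:
  fixes \<rho> :: "'a :: finite_field \<Rightarrow> complex"
  assumes \<rho>: "\<rho> \<in> carrier char_group" and z: "mult_generator z"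
    and \<rho>z: "\<rho> z ^ 3 = 1" "\<rho> z \<noteq> 1"
    and \<zeta>: "(\<zeta> :: 'a) \<noteq> 1" "\<zeta> ^ 2 + \<zeta> + 1 = 0" and three: "(3 :: 'a) \<noteq> 0"
    and t: "t \<noteq> 0"
  shows "of_nat (card {s \<in> -{0}. s ^ 3 = t}) = 1 + \<rho> t + \<rho> t ^ 2"
proof (cases "\<exists>r. t = r ^ 3")
  case True
  then obtain r where r: "t = r ^ 3" "r \<noteq> 0"
    using t by auto
  have "s ^ 3 - r ^ 3 = (s - r) * (s - \<zeta> * r) * (s - \<zeta> ^ 2 * r)" for s
    using \<zeta>(2) by Groebner_Basis.algebra
  then have "{s \<in> -{0}. s ^ 3 = t} = {r, \<zeta> * r, \<zeta> ^ 2 * r}"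
    using r \<zeta> by (auto simp: eq_iff_diff_eq_0[of "_ ^ 3"])
  moreover have "\<zeta> ^ 2 \<noteq> 1" "\<zeta> ^ 2 \<noteq> \<zeta>"
  proof -
    \<comment> \<open>Both identities express \<open>3\<close> so that it vanishes as soon as
      \<open>\<zeta> ^ 2 + \<zeta> + 1\<close> and \<open>\<zeta> ^ 2 - 1\<close>, respectively
      \<open>\<zeta> ^ 2 - \<zeta>\<close>, both do.\<close>
    have eq1: "3 = (\<zeta> ^ 2 - 1) - ((\<zeta> ^ 2 + \<zeta> + 1) - (\<zeta> ^ 2 - 1)) * (\<zeta> - 2)"
      and eq2: "3 = 4 * (\<zeta> ^ 2 + \<zeta> + 1) - ((\<zeta> ^ 2 + \<zeta> + 1) - (\<zeta> ^ 2 - \<zeta>)) ^ 2"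
      by Groebner_Basis.algebra+
    have "(3 :: 'a) = 0" if "\<zeta> ^ 2 = 1"
      using eq1 unfolding \<zeta>(2) unfolding that by simp
    moreover have "(3 :: 'a) = 0" if "\<zeta> ^ 2 = \<zeta>"
      using eq2 unfolding \<zeta>(2) unfolding that by simp
    ultimately show "\<zeta> ^ 2 \<noteq> 1" "\<zeta> ^ 2 \<noteq> \<zeta>"
      using three by blast+
  qed
  ultimately have "card {s \<in> -{0}. s ^ 3 = t} = 3"
    using r \<zeta>(1) by (simp add: card_insert_if)
  moreover have "\<rho> t = 1"
    using cubic_char_cube[OF \<rho> z \<rho>z(1) r(2)] by (simp add: r char_power[OF \<rho>])
  ultimately show ?thesis
    by simp
next
  case False
  obtain i where i: "t = z ^ i"
    using mult_generatorE[OF z t] .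
  have "\<not> 3 dvd i"
    using False i by (auto elim!: dvdE simp: mult.commute[of 3] power_mult)
  then have "i mod 3 = 1 \<or> i mod 3 = 2"
    by presburger
  moreover have "\<rho> t = \<rho> z ^ (i mod 3)"
  proof -
    have "\<rho> z ^ i = \<rho> z ^ (3 * (i div 3)) * \<rho> z ^ (i mod 3)"
      by (subst power_add [symmetric]) simp
    then show ?thesis
      by (simp add: i char_power[OF \<rho>] power_mult \<rho>z)
  qed
  moreover have "\<rho> z ^ 2 \<noteq> 1"
    using \<rho>z by (metis mult_1 power2_eq_square power3_eq_cube)
  ultimately have "\<rho> t \<noteq> 1"
    using \<rho>z by auto
  moreover have "(\<rho> t - 1) * (1 + \<rho> t + \<rho> t ^ 2) = 0"
    using cubic_char_cube[OF \<rho> z \<rho>z(1) t] by (simp add: algebra_simps power2_eq_square power3_eq_cube)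
  ultimately have "1 + \<rho> t + \<rho> t ^ 2 = 0"
    by simp
  moreover have "{s \<in> -{0}. s ^ 3 = t} = {}"
    using False by auto
  ultimately show ?thesis
    by simp
qed

lemma sum_cubes:
  fixes \<rho> G :: "'a :: finite_field \<Rightarrow> complex"
  assumes "\<rho> \<in> carrier char_group" and "mult_generator z"
    and "\<rho> z ^ 3 = 1" "\<rho> z \<noteq> 1"
    and "(\<zeta> :: 'a) \<noteq> 1" "\<zeta> ^ 2 + \<zeta> + 1 = 0" and "(3 :: 'a) \<noteq> 0"
  shows "(\<Sum>s\<in>-{0}. G (s ^ 3)) = (\<Sum>t\<in>-{0}. (1 + \<rho> t + \<rho> t ^ 2) * G t)"
proof -
  have "(\<Sum>s\<in>-{0}. G (s ^ 3)) = (\<Sum>t\<in>UNIV. of_nat (card {s \<in> -{0}. s ^ 3 = t}) * G t)"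
    by (rule sum_comp_card) simp
  also have "\<dots> = (\<Sum>t\<in>-{0}. of_nat (card {s \<in> -{0}. s ^ 3 = t}) * G t)"
    by (intro sum.mono_neutral_right) auto
  also have "\<dots> = (\<Sum>t\<in>-{0}. (1 + \<rho> t + \<rho> t ^ 2) * G t)"
    by (intro sum.cong refl arg_cong2[of _ _ _ _ "(*)"] card_cube_roots[OF assms]) simp
  finally show ?thesis .
qed

text \<open>
  Writing \<open>w = s + 1 / s\<close>, the map is \<open>s \<mapsto> s\<^sup>3\<close>. If \<open>w\<^sup>2 - 4\<close> is not a square, \<open>s\<close> lies in the
  subgroup of order \<open>q + 1\<close> of a quadratic extension, and \<open>q + 1\<close> is prime to 3.
\<close>

lemma bij_betw_chebyshev_nonsplit:
  fixes \<zeta> :: "'a :: finite_field"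
  assumes two: "(2 :: 'a) \<noteq> 0" and three: "(3 :: 'a) \<noteq> 0" and \<zeta>: "\<zeta> ^ 2 + \<zeta> + 1 = 0"
  defines "E \<equiv> {w :: 'a. quadratic_char (w ^ 2 - 4) \<noteq> 1}"
  shows "bij_betw (\<lambda>w. w ^ 3 - 3 * w) E E"
    and "w \<in> E \<Longrightarrow> quadratic_char ((w ^ 3 - 3 * w) ^ 2 - 4) = quadratic_char (w ^ 2 - 4)"
proof -
  \<comment> \<open>A primitive cube root of unity makes \<open>- 3\<close> a square; this is what
    excludes \<open>w ^ 2 = 1\<close> on \<open>E\<close>, where \<open>w ^ 2 - 4\<close> would be
    \<open>- 3\<close>.\<close>
  have m3: "(1 + 2 * \<zeta>) ^ 2 = - 3"
    using \<zeta> by Groebner_Basis.algebra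
  have \<zeta>0: "1 + 2 * \<zeta> \<noteq> 0"
    using m3 three by auto
  show qc: "quadratic_char ((w ^ 3 - 3 * w) ^ 2 - 4) = quadratic_char (w ^ 2 - 4)" if "w \<in> E" for w
  proof -
    have "w ^ 2 - 1 \<noteq> 0"
    proof
      assume "w ^ 2 - 1 = 0"
      then have "w ^ 2 - 4 = (1 + 2 * \<zeta>) ^ 2"
        using m3 by Groebner_Basis.algebra
      then show False
        using that \<zeta>0 by (simp add: E_def)
    qed
    moreover have "(w ^ 3 - 3 * w) ^ 2 - 4 = (w ^ 2 - 1) ^ 2 * (w ^ 2 - 4)"
      by Groebner_Basis.algebra
    ultimately show ?thesis
      using quadratic_char_square_mult[OF two] by simp
  qed
  \<comment> \<open>The quadratic is the cofactor of \<open>u - v\<close> in the difference of the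
    values at \<open>u\<close> and \<open>v\<close>. It gives
    \<open>(2 * u + v) ^ 2 = - 3 * (v ^ 2 - 4)\<close>, so \<open>v ^ 2 - 4\<close> would be a
    nonzero square unless it is \<open>0\<close>.\<close>
  have E_root: "v ^ 2 = 4" if "v \<in> E" "u ^ 2 + u * v + v ^ 2 = 3" for u v
  proof (rule ccontr)
    assume "v ^ 2 \<noteq> 4"
    have eq: "(2 * u + v) ^ 2 = (1 + 2 * \<zeta>) ^ 2 * (v ^ 2 - 4)"
    proof -
      have "(2 * u + v) ^ 2 - (- 3) * (v ^ 2 - 4) = 4 * (u ^ 2 + u * v + v ^ 2 - 3)"
        by Groebner_Basis.algebra
      then show ?thesis
        unfolding m3 that(2) by simp
    qed
    then have "2 * u + v \<noteq> 0"
      using \<zeta>0 \<open>v ^ 2 \<noteq> 4\<close> by auto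
    then have "quadratic_char ((1 + 2 * \<zeta>) ^ 2 * (v ^ 2 - 4)) = 1"
      unfolding eq [symmetric] by simp
    then show False
      using that(1) quadratic_char_square_mult[OF two \<zeta>0] by (simp add: E_def)
  qed
  have "inj_on (\<lambda>w. w ^ 3 - 3 * w) E"
  proof (rule inj_onI, rule ccontr)
    fix u v assume uv: "u \<in> E" "v \<in> E" "u ^ 3 - 3 * u = v ^ 3 - 3 * v" "u \<noteq> v"
    have "(u - v) * (u ^ 2 + u * v + v ^ 2 - 3) = 0"
      using uv(3) by Groebner_Basis.algebra
    then have *: "u ^ 2 + u * v + v ^ 2 = 3"
      using uv(4) by simp
    \<comment> \<open>The cofactor is symmetric in \<open>u\<close> and \<open>v\<close>. For
      \<open>u = - v\<close> it equals \<open>v ^ 2 = 4\<close>, against the value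
      \<open>3\<close>.\<close>
    then have "v ^ 2 = 4" "u ^ 2 = 4"
      using E_root[of v u] E_root[of u v] uv by (simp_all add: ac_simps)
    moreover from this have "u = - v"
      using uv(4) by (metis power2_eq_iff)
    ultimately have "(4 :: 'a) = 3"
      using * by (simp add: power2_eq_square)
    then have "(4 :: 'a) - 3 = 0"
      by simp
    then show False
      by simp
  qed
  moreover have "(\<lambda>w. w ^ 3 - 3 * w) ` E \<subseteq> E"
    using qc by (auto simp: E_def)
  ultimately show "bij_betw (\<lambda>w. w ^ 3 - 3 * w) E E"
    by (simp add: bij_betw_def endo_inj_surj)
qed

text \<open>Twice the left-hand sum is split with the weights \<open>1 + ?q w\<close> and
  \<open>1 - ?q w\<close>. The first part is pulled back along \<open>w = s + 1 / s\<close>, where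
  the map becomes cubing; the second is supported on the set that the map permutes. The terms free
  of \<open>\<rho>\<close> recombine to twice the sum of \<open>F\<close>.\<close>

lemma sum_chebyshev:
  fixes \<rho> F :: "'a :: finite_field \<Rightarrow> complex"
  assumes two: "(2 :: 'a) \<noteq> 0" and three: "(3 :: 'a) \<noteq> 0"
    and \<rho>: "\<rho> \<in> carrier char_group" and z: "mult_generator z"
    and \<rho>z: "\<rho> z ^ 3 = 1" "\<rho> z \<noteq> 1"
    and \<zeta>: "(\<zeta> :: 'a) \<noteq> 1" "\<zeta> ^ 2 + \<zeta> + 1 = 0"
  shows "(\<Sum>w\<in>UNIV. F (w ^ 3 - 3 * w)) = (\<Sum>t\<in>-{0}. \<rho> t * F (t + 1 / t)) + (\<Sum>u\<in>UNIV. F u)"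
proof -
  let ?q = "\<lambda>w :: 'a. quadratic_char (w ^ 2 - 4)"
  let ?C = "\<lambda>w :: 'a. w ^ 3 - 3 * w"
  let ?E = "{w. ?q w \<noteq> 1}"
  have split: "(\<Sum>w\<in>UNIV. (1 + ?q w) * F (?C w)) = (\<Sum>t\<in>-{0}. (1 + \<rho> t + \<rho> t ^ 2) * F (t + 1 / t))"
  proof -
    have "(\<Sum>w\<in>UNIV. (1 + ?q w) * F (?C w)) = (\<Sum>s\<in>-{0}. F (?C (s + 1 / s)))"
      by (rule sum_add_inverse[OF two, symmetric])
    also have "\<dots> = (\<Sum>s\<in>-{0}. F (s ^ 3 + 1 / s ^ 3))"
    proof (intro sum.cong refl)
      fix s :: 'a assume "s \<in> -{0}"
      then have "?C (s + 1 / s) = s ^ 3 + 1 / s ^ 3"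
        by (simp add: field_simps) Groebner_Basis.algebra
      then show "F (?C (s + 1 / s)) = F (s ^ 3 + 1 / s ^ 3)"
        by simp
    qed
    also have "\<dots> = (\<Sum>t\<in>-{0}. (1 + \<rho> t + \<rho> t ^ 2) * F (t + 1 / t))"
      by (rule sum_cubes[OF \<rho> z \<rho>z \<zeta> three, where G = "\<lambda>t. F (t + 1 / t)"])
    finally show ?thesis .
  qed
  have nonsplit: "(\<Sum>w\<in>UNIV. (1 - ?q w) * F (?C w)) = (\<Sum>u\<in>UNIV. (1 - ?q u) * F u)"
  proof -
    have "(\<Sum>w\<in>UNIV. (1 - ?q w) * F (?C w)) = (\<Sum>w\<in>?E. (1 - ?q w) * F (?C w))"
      by (intro sum.mono_neutral_right) auto
    also have "\<dots> = (\<Sum>w\<in>?E. (1 - ?q (?C w)) * F (?C w))"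
      by (intro sum.cong refl) (simp add: bij_betw_chebyshev_nonsplit(2)[OF two three \<zeta>(2)])
    also have "\<dots> = (\<Sum>u\<in>?E. (1 - ?q u) * F u)"
      by (rule sum.reindex_bij_betw[OF bij_betw_chebyshev_nonsplit(1)[OF two three \<zeta>(2)]])
    also have "\<dots> = (\<Sum>u\<in>UNIV. (1 - ?q u) * F u)"
      by (intro sum.mono_neutral_left) auto
    finally show ?thesis .
  qed
  \<comment> \<open>Inversion fixes \<open>t + 1 / t\<close> and exchanges \<open>\<rho>\<close>
    with its square, since \<open>\<rho> t ^ 3 = 1\<close>.\<close>
  have swap: "(\<Sum>t\<in>-{0}. \<rho> t ^ 2 * F (t + 1 / t)) = (\<Sum>t\<in>-{0}. \<rho> t * F (t + 1 / t))"
  proof (rule sum.reindex_bij_witness[of _ inverse inverse])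
    fix t :: 'a assume t: "t \<in> -{0}"
    then have "\<rho> t * \<rho> t ^ 2 = 1"
      using cubic_char_cube[OF \<rho> z \<rho>z(1), of t] by (simp add: power2_eq_square power3_eq_cube mult.assoc)
    then have "\<rho> (inverse t) = \<rho> t ^ 2"
      by (simp add: char_inverse[OF \<rho>] inverse_unique)
    then show "\<rho> (inverse t) * F (inverse t + 1 / inverse t) = \<rho> t ^ 2 * F (t + 1 / t)"
      by (simp add: field_simps)
  qed auto
  have "2 * (\<Sum>w\<in>UNIV. F (?C w)) =
      (\<Sum>w\<in>UNIV. (1 + ?q w) * F (?C w)) + (\<Sum>w\<in>UNIV. (1 - ?q w) * F (?C w))"
    by (simp add: sum_distrib_left algebra_simps flip: sum.distrib)
  also have "\<dots> = (\<Sum>t\<in>-{0}. F (t + 1 / t)) + 2 * (\<Sum>t\<in>-{0}. \<rho> t * F (t + 1 / t)) +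
      (\<Sum>u\<in>UNIV. (1 - ?q u) * F u)"
    unfolding split nonsplit using swap by (simp add: distrib_right sum.distrib)
  also have "(\<Sum>t\<in>-{0}. F (t + 1 / t)) = (\<Sum>u\<in>UNIV. (1 + ?q u) * F u)"
    by (rule sum_add_inverse[OF two])
  finally have "2 * (\<Sum>w\<in>UNIV. F (?C w)) =
      2 * ((\<Sum>t\<in>-{0}. \<rho> t * F (t + 1 / t)) + (\<Sum>u\<in>UNIV. F u))"
    by (simp add: distrib_right left_diff_distrib sum.distrib sum_subtractf distrib_left)
  then show ?thesis
    unfolding mult_cancel_left by simp
qed

section \<open>Greene's series with characters of order six\<close>

lemma sum_quadratic_pullback:
  fixes \<chi> :: "'a :: finite_field \<Rightarrow> complex"
  assumes two: "(2 :: 'a) \<noteq> 0" and \<chi>: "\<chi> \<in> carrier char_group" and x: "x \<noteq> 0" "x \<noteq> 1"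
  shows "(\<Sum>y\<in>UNIV. \<chi> y * inverse (\<chi> (1 - y)) * \<chi> (1 - x * y)) =
    (\<Sum>t\<in>UNIV. (1 + quadratic_char ((1 + t) ^ 2 - 4 * x * t)) * \<chi> t)"
proof -
  let ?f = "\<lambda>y. y * (1 - x * y) / (1 - y)"
  have "(\<Sum>y\<in>UNIV. \<chi> y * inverse (\<chi> (1 - y)) * \<chi> (1 - x * y)) = (\<Sum>y\<in>UNIV. \<chi> (?f y))"
    \<comment> \<open>At \<open>y = 1\<close> both summands are \<open>0\<close>, by the conventions
      \<open>inverse 0 = 0\<close>, division by zero and \<open>\<chi> 0 = 0\<close>.\<close>
    by (intro sum.cong refl) (simp add: divide_inverse char_mult[OF \<chi>] char_inverse[OF \<chi>] ac_simps)
  also have "\<dots> = (\<Sum>y\<in>-{1}. \<chi> (?f y))"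
    by (intro sum.mono_neutral_right) (auto simp: char_0[OF \<chi>])
  also have "\<dots> = (\<Sum>t\<in>UNIV. of_nat (card {y \<in> -{1}. ?f y = t}) * \<chi> t)"
    by (rule sum_comp_card) simp
  also have "\<dots> = (\<Sum>t\<in>UNIV. (1 + quadratic_char ((1 + t) ^ 2 - 4 * x * t)) * \<chi> t)"
  proof (intro sum.cong refl)
    fix t :: 'a
    have "?f y = t \<longleftrightarrow> x * y ^ 2 + - (1 + t) * y + t = 0" if "y \<noteq> 1" for y
    proof -
      have "?f y = t \<longleftrightarrow> y * (1 - x * y) = t * (1 - y)"
        using that by (simp add: divide_eq_eq)
      also have "\<dots> \<longleftrightarrow> x * y ^ 2 + - (1 + t) * y + t = 0"
        by Groebner_Basis.algebra
      finally show ?thesis .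
    qed
    \<comment> \<open>At \<open>y = 1\<close> the quadratic takes the value \<open>x - 1\<close>, so
      the excluded point is never a root.\<close>
    moreover have "y \<noteq> 1" if "x * y ^ 2 + - (1 + t) * y + t = 0" for y
      using that x by auto
    ultimately have "{y \<in> -{1}. ?f y = t} = {y. x * y ^ 2 + - (1 + t) * y + t = 0}"
      by auto
    then show "of_nat (card {y \<in> -{1}. ?f y = t}) * \<chi> t =
        (1 + quadratic_char ((1 + t) ^ 2 - 4 * x * t)) * \<chi> t"
      using card_quadratic_roots[OF two x(1), of "- (1 + t)" t] by (simp only: power2_minus)
  qed
  finally show ?thesis .
qed

lemma primitive_cube_root_exists:
  assumes "3 dvd CARD('a :: finite_field) - 1"
  shows "\<exists>\<zeta> :: 'a. \<zeta> \<noteq> 1 \<and> \<zeta> ^ 2 + \<zeta> + 1 = 0"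
proof -
  obtain m where n: "CARD('a) - 1 = 3 * m"
    using assms by blast
  have "CARD('a) > 1"
    using card_mono[of UNIV "{0, 1 :: 'a}"] by simp
  with n have m: "m > 0"
    by (cases m) auto
  obtain z :: 'a where z: "mult_generator z"
    using mult_generator_exists by blast
  have "\<not> 3 * m dvd m"
    using m nat_dvd_not_less[of m "3 * m"] by simp
  then have \<zeta>: "z ^ m \<noteq> 1" "(z ^ m) ^ 3 = 1"
    using mult_generator_power_eq_1_iff[OF z, unfolded n] by (simp_all add: mult.commute flip: power_mult)
  moreover have "(z ^ m - 1) * ((z ^ m) ^ 2 + z ^ m + 1) = (z ^ m) ^ 3 - 1"
    by Groebner_Basis.algebra
  ultimately have "(z ^ m) ^ 2 + z ^ m + 1 = 0"
    by simp
  with \<zeta> show ?thesis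
    by blast
qed

text \<open>In characteristic three \<open>\<zeta> ^ 2 + \<zeta> + 1\<close> is
  \<open>(\<zeta> - 1) ^ 2\<close>, so a primitive cube root of unity could not exist.\<close>

lemma three_nonzero:
  assumes "3 dvd CARD('a :: finite_field) - 1"
  shows "(3 :: 'a) \<noteq> 0"
proof
  assume three: "(3 :: 'a) = 0"
  obtain \<zeta> :: 'a where \<zeta>: "\<zeta> \<noteq> 1" "\<zeta> ^ 2 + \<zeta> + 1 = 0"
    using primitive_cube_root_exists[OF assms] by blast
  have "(\<zeta> - 1) ^ 2 = (\<zeta> ^ 2 + \<zeta> + 1) - 3 * \<zeta>"
    by Groebner_Basis.algebra
  then show False
    using \<zeta> three by simp
qed

lemma greene_2F1_order_six:
  fixes T :: "'a :: finite_field \<Rightarrow> complex" and x :: 'a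
  assumes two: "(2 :: 'a) \<noteq> 0" and q: "[CARD('a) = 1] (mod 6)"
    and T: "T \<in> carrier char_group" "generate char_group {T} = carrier char_group"
    and x: "x \<noteq> 0" "x \<noteq> 1"
  shows "of_nat CARD('a) *
      greene_2F1 (T [^]\<^bsub>char_group\<^esub> ((CARD('a) - 1) div 6))
        (T [^]\<^bsub>char_group\<^esub> (5 * (CARD('a) - 1) div 6)) trivial_char x =
    quadratic_char (- 1 :: 'a) * (\<Sum>w\<in>UNIV. quadratic_char (w ^ 3 - 3 * w + (2 - 4 * x)))"
proof -
  let ?n = "CARD('a) - 1"
  have card: "CARD('a) > 1"
    using card_mono[of UNIV "{0, 1 :: 'a}"] by simp
  then have "6 dvd ?n"
    using q unfolding cong_def by presburger
  then obtain m where n: "?n = 6 * m"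
    by blast
  with card have m: "m > 0"
    by simp
  obtain z :: 'a where z: "mult_generator z"
    using mult_generator_exists by blast
  have z0: "z \<noteq> 0"
    using z by (simp add: mult_generator_def)
  \<comment> \<open>With \<open>q - 1 = 6 * m\<close>, \<open>\<omega>\<close> and
    \<open>\<chi>\<close> are mutually inverse characters of order six, and
    \<open>5 * m = 3 * m + 2 * m\<close> splits \<open>\<chi>\<close> into the quadratic character
    and the cubic \<open>\<rho>\<close>.\<close>
  define \<omega> where "\<omega> = T [^]\<^bsub>char_group\<^esub> m"
  define \<chi> where "\<chi> = T [^]\<^bsub>char_group\<^esub> (5 * m)"
  define \<rho> where "\<rho> = T [^]\<^bsub>char_group\<^esub> (2 * m)"
  have cg: "\<omega> \<in> carrier char_group" "\<chi> \<in> carrier char_group" "\<rho> \<in> carrier char_group"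
    by (simp_all add: \<omega>_def \<chi>_def \<rho>_def T char_group_pow_closed)
  have apply_\<omega>: "\<omega> y = T y ^ m" and apply_\<chi>: "\<chi> y = T y ^ (5 * m)"
    and apply_\<rho>: "\<rho> y = T y ^ (2 * m)" for y
    unfolding \<omega>_def \<chi>_def \<rho>_def using m by (simp_all add: char_group_pow_apply T)
  have T_pow: "T y ^ (6 * m) = 1" if "y \<noteq> 0" for y
  proof -
    have "T y ^ (6 * m) = T (y ^ ?n)"
      by (simp only: n char_power[OF T(1)])
    then show ?thesis
      by (simp only: power_card_minus_1[OF that] char_1[OF T(1)])
  qed
  have ne_1: "T z ^ k \<noteq> 1" if "k > 0" "k < 6 * m" for k
    using char_generator_power_eq_1[OF T z, of k, unfolded n] that nat_dvd_not_less by blast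
  have \<omega>_\<chi>: "\<omega> y = inverse (\<chi> y)" for y
  proof (cases "y = 0")
    case False
    have "\<chi> y * \<omega> y = T y ^ (5 * m + m)"
      by (simp only: apply_\<chi> apply_\<omega> power_add)
    then have "\<chi> y * \<omega> y = 1"
      using T_pow[OF False] by simp
    then show ?thesis
      by (simp add: inverse_unique)
  qed (simp add: char_0 cg)
  have qc: "quadratic_char y = T y ^ (3 * m)" for y
  proof (cases "y = 0")
    case False
    \<comment> \<open>\<open>T z ^ (3 * m)\<close> is a square root of \<open>1\<close> other than
      \<open>1\<close>, hence \<open>- 1\<close>, as for the quadratic character at a
      generator.\<close>
    have "(T z ^ (3 * m)) ^ 2 = 1"
      using T_pow[OF z0] by (simp flip: power_mult)
    then have "T z ^ (3 * m) = - 1"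
      using ne_1[of "3 * m"] m by (auto simp: power2_eq_1_iff)
    moreover obtain i where i: "y = z ^ i"
      using mult_generatorE[OF z False] .
    moreover have "T y ^ (3 * m) = (T z ^ (3 * m)) ^ i"
      by (simp add: i char_power T mult.commute flip: power_mult)
    ultimately show ?thesis
      by (simp add: quadratic_char_generator_power[OF z two])
  qed (use m in \<open>simp add: char_0 T\<close>)
  have \<chi>_split: "\<chi> y = quadratic_char y * \<rho> y" for y
    by (simp add: qc apply_\<chi> apply_\<rho> flip: power_add)
  have \<rho>z: "\<rho> z ^ 3 = 1" "\<rho> z \<noteq> 1"
    using T_pow[OF z0] ne_1[of "2 * m"] m by (simp_all add: apply_\<rho> mult.commute flip: power_mult)
  obtain \<zeta> :: 'a where \<zeta>: "\<zeta> \<noteq> 1" "\<zeta> ^ 2 + \<zeta> + 1 = 0"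
    using primitive_cube_root_exists[where 'a = 'a] n by auto
  have three: "(3 :: 'a) \<noteq> 0"
    using n by (intro three_nonzero) simp
  have \<chi>_sum: "(\<Sum>t\<in>UNIV. \<chi> t) = 0"
    using ne_1[of "5 * m"] m by (intro sum_char_nontrivial[OF cg(2) z0]) (simp add: apply_\<chi>)
  have pow: "T [^]\<^bsub>char_group\<^esub> (?n div 6) = \<omega>" "T [^]\<^bsub>char_group\<^esub> (5 * ?n div 6) = \<chi>"
    unfolding \<omega>_def \<chi>_def n by simp_all
  have \<chi>_minus_1: "\<chi> (- 1) = quadratic_char (- 1 :: 'a)"
  proof -
    have "\<rho> (- 1) = 1"
      using T by (simp add: apply_\<rho> power_mult flip: char_power) (simp add: char_1)
    then show ?thesis
      by (simp add: \<chi>_split)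
  qed
  have "of_nat CARD('a) * greene_2F1 \<omega> \<chi> trivial_char x =
      \<chi> (- 1) * (\<Sum>y\<in>UNIV. \<chi> y * (inverse (\<chi> (1 - y)) * trivial_char (1 - y)) * \<chi> (1 - x * y))"
  proof -
    have "trivial_char x = 1"
      using x by (simp add: trivial_char_def)
    moreover have "(\<chi> \<otimes>\<^bsub>char_group\<^esub> trivial_char) (- 1) = \<chi> (- 1)"
      by (simp add: char_group_def trivial_char_def)
    moreover have "(inv\<^bsub>char_group\<^esub> \<chi> \<otimes>\<^bsub>char_group\<^esub> trivial_char) y =
        inverse (\<chi> y) * trivial_char y" for y
      unfolding inv_char_group[OF cg(2)] by (simp add: char_group_def)
    moreover have "(inv\<^bsub>char_group\<^esub> \<omega>) y = \<chi> y" for y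
      unfolding inv_char_group[OF cg(1)] by (simp add: \<omega>_\<chi>)
    ultimately show ?thesis
      using card by (simp add: greene_2F1_def)
  qed
  also have "(\<Sum>y\<in>UNIV. \<chi> y * (inverse (\<chi> (1 - y)) * trivial_char (1 - y)) * \<chi> (1 - x * y)) =
      (\<Sum>y\<in>UNIV. \<chi> y * inverse (\<chi> (1 - y)) * \<chi> (1 - x * y))"
    by (intro sum.cong refl) (auto simp: trivial_char_def char_0 cg)
  also have "\<dots> = (\<Sum>t\<in>UNIV. (1 + quadratic_char ((1 + t) ^ 2 - 4 * x * t)) * \<chi> t)"
    by (rule sum_quadratic_pullback[OF two cg(2) x])
  \<comment> \<open>The constant \<open>1\<close> of the root count contributes the sum of the
    nontrivial character \<open>\<chi>\<close>, which is \<open>0\<close>.\<close>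
  also have "\<dots> = (\<Sum>t\<in>UNIV. \<chi> t * quadratic_char ((1 + t) ^ 2 - 4 * x * t))"
    using \<chi>_sum by (simp add: distrib_left sum.distrib mult.commute)
  also have "\<dots> = (\<Sum>t\<in>-{0}. \<chi> t * quadratic_char ((1 + t) ^ 2 - 4 * x * t))"
    by (intro sum.mono_neutral_right) (auto simp: char_0 cg)
  also have "\<dots> = (\<Sum>t\<in>-{0}. \<rho> t * quadratic_char (t + 1 / t + (2 - 4 * x)))"
  proof (intro sum.cong refl)
    fix t :: 'a assume "t \<in> -{0}"
    then have "t \<noteq> 0"
      by simp
    \<comment> \<open>The quadratic factor of \<open>\<chi> t\<close> supplies the extra
      \<open>t\<close> that turns the discriminant into a square times a function of
      \<open>t + 1 / t\<close>.\<close>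
    have "t * ((1 + t) ^ 2 - 4 * x * t) = t ^ 2 * (t + 1 / t + (2 - 4 * x))"
      using \<open>t \<noteq> 0\<close> by (simp add: field_simps) Groebner_Basis.algebra
    then have "quadratic_char t * quadratic_char ((1 + t) ^ 2 - 4 * x * t) =
        quadratic_char (t + 1 / t + (2 - 4 * x))"
      by (simp only: quadratic_char_square_mult[OF two \<open>t \<noteq> 0\<close>] flip: quadratic_char_mult[OF two])
    then show "\<chi> t * quadratic_char ((1 + t) ^ 2 - 4 * x * t) =
        \<rho> t * quadratic_char (t + 1 / t + (2 - 4 * x))"
      by (simp add: \<chi>_split ac_simps)
  qed
  also have "\<dots> = (\<Sum>w\<in>UNIV. quadratic_char (w ^ 3 - 3 * w + (2 - 4 * x)))"
  proof -
    \<comment> \<open>This is the second sum produced by \<open>sum_chebyshev\<close>; a translate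
      of the quadratic character still sums to \<open>0\<close>.\<close>
    have "(\<Sum>u\<in>UNIV. quadratic_char (u + (2 - 4 * x))) = (\<Sum>u\<in>UNIV. quadratic_char (u :: 'a))"
      by (rule sum.reindex_bij_witness[of _ "\<lambda>u. u - (2 - 4 * x)" "\<lambda>u. u + (2 - 4 * x)"]) auto
    then show ?thesis
      using sum_chebyshev[OF two three cg(3) z \<rho>z \<zeta>, of "\<lambda>u. quadratic_char (u + (2 - 4 * x))"]
        sum_quadratic_char[where 'a = 'a, OF two] by simp
  qed
  finally show ?thesis
    unfolding pow \<chi>_minus_1 .
qed

section \<open>From the quartic sum to a cubic without linear term\<close>

lemma phi111_eq_sum_cubic:
  fixes a b c :: "'a :: finite_field"
  assumes two: "(2 :: 'a) \<noteq> 0" and nz: "a \<noteq> 0" "b \<noteq> 0" "c \<noteq> 0"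
  shows "phi111 a b c =
    - 1 + quadratic_char (b * c) * (\<Sum>y\<in>UNIV. quadratic_char ((y + 1) * (y + a / b) * (y + a / c)))"
proof -
  let ?P = "\<lambda>y. quadratic_char ((y + 1) * (y + a / b) * (y + a / c))"
  have "phi111 a b c = (\<Sum>x\<in>-{0}. quadratic_char (x * (x + a) * (x + b) * (x + c)))"
    unfolding phi111_def
    by (intro sum.mono_neutral_cong_right) (auto simp: quadratic_char_mult[OF two])
  also have "\<dots> = (\<Sum>y\<in>-{0}. quadratic_char (b * c) * ?P y)"
  proof (rule sum.reindex_bij_witness[of _ "\<lambda>y. a / y" "\<lambda>x. a / x"])
    fix x assume "x \<in> -{0 :: 'a}"
    then have x: "x \<noteq> 0"
      by simp
    have "x * (x + a) * (x + b) * (x + c) =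
        (x ^ 2 / a) ^ 2 * ((b * c) * ((a / x + 1) * (a / x + a / b) * (a / x + a / c)))"
      using nz x by (simp add: field_simps power2_eq_square)
    then show "quadratic_char (b * c) * ?P (a / x) = quadratic_char (x * (x + a) * (x + b) * (x + c))"
      using nz x by (simp only: quadratic_char_square_mult[OF two] quadratic_char_mult[OF two, of "b * c"])
        (simp add: quadratic_char_square_mult[OF two] quadratic_char_mult[OF two, of "b * c"])
  qed (use nz in auto)
  also have "\<dots> = quadratic_char (b * c) * ((\<Sum>y\<in>UNIV. ?P y) - ?P 0)"
    by (simp add: Compl_eq_Diff_UNIV sum_diff1 sum_distrib_left right_diff_distrib)
  \<comment> \<open>Under \<open>x = a / y\<close> no \<open>x\<close> corresponds to
    \<open>y = 0\<close>; completing the sum by this term produces the \<open>- 1\<close>.\<close>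
  moreover have "quadratic_char (b * c) * ?P 0 = 1"
  proof -
    have "quadratic_char (b * c) * ?P 0 = quadratic_char (a ^ 2)"
      using nz by (simp add: power2_eq_square flip: quadratic_char_mult[OF two])
    then show ?thesis
      using nz by simp
  qed
  ultimately show ?thesis
    by (simp add: right_diff_distrib)
qed

text \<open>The critical points \<open>0\<close> and \<open>- 2 * f / 3\<close> of
  \<open>y ^ 3 + f * y ^ 2 + g\<close> are moved by an affine map to \<open>1\<close> and
  \<open>- 1\<close>, those of \<open>w ^ 3 - 3 * w\<close>.\<close>

lemma sum_quadratic_char_depressed:
  fixes f g :: "'a :: finite_field"
  assumes two: "(2 :: 'a) \<noteq> 0" and three: "(3 :: 'a) \<noteq> 0" and f: "f \<noteq> 0"
  shows "(\<Sum>y\<in>UNIV. quadratic_char (y ^ 3 + f * y ^ 2 + g)) =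
    quadratic_char (3 * f) *
      (\<Sum>w\<in>UNIV. quadratic_char (w ^ 3 - 3 * w + (2 - 4 * (- (3 ^ 3 * g / (2 ^ 2 * f ^ 3))))))"
proof -
  let ?x = "- (3 ^ 3 * g / (2 ^ 2 * f ^ 3))"
  have "(\<Sum>y\<in>UNIV. quadratic_char (y ^ 3 + f * y ^ 2 + g)) =
      (\<Sum>w\<in>UNIV. quadratic_char (3 * f) * quadratic_char (w ^ 3 - 3 * w + (2 - 4 * ?x)))"
  proof (rule sum.reindex_bij_witness[of _ "\<lambda>w. f / 3 * (w - 1)" "\<lambda>y. 3 * y / f + 1"])
    fix y :: 'a
    let ?w = "3 * y / f + 1"
    have four: "(4 :: 'a) \<noteq> 0"
    proof -
      have "(4 :: 'a) = 2 * 2"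
        by simp
      then show ?thesis
        using two by (metis mult_eq_0_iff)
    qed
    have nine: "(9 :: 'a) \<noteq> 0"
    proof -
      have "(9 :: 'a) = 3 * 3"
        by simp
      then show ?thesis
        using three by (metis mult_eq_0_iff)
    qed
    \<comment> \<open>Scaling by powers of \<open>f\<close> exhibits both arguments as a square,
      \<open>9 ^ 2\<close> or \<open>f ^ 2\<close>, times the same
      \<open>f * (p ^ 3 + p ^ 2 + r)\<close>.\<close>
    define p where "p = y / f"
    define r where "r = g / f ^ 3"
    have yg: "y = f * p" "g = f ^ 3 * r"
      using f by (simp_all add: p_def r_def)
    have x: "4 * ?x = - 27 * r" and w: "?w = 3 * p + 1"
      using four f by (simp_all add: p_def r_def field_simps)
    have "3 * f * (?w ^ 3 - 3 * ?w + (2 - 4 * ?x)) = 9 ^ 2 * (f * (p ^ 3 + p ^ 2 + r))"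
      unfolding x w by Groebner_Basis.algebra
    moreover have "y ^ 3 + f * y ^ 2 + g = f ^ 2 * (f * (p ^ 3 + p ^ 2 + r))"
      unfolding yg by Groebner_Basis.algebra
    ultimately show "quadratic_char (3 * f) * quadratic_char (?w ^ 3 - 3 * ?w + (2 - 4 * ?x)) =
        quadratic_char (y ^ 3 + f * y ^ 2 + g)"
      using quadratic_char_square_mult[OF two f] quadratic_char_square_mult[OF two nine]
      by (simp only: flip: quadratic_char_mult[OF two])
  qed (use f three in \<open>auto simp: field_simps\<close>)
  then show ?thesis
    by (simp add: sum_distrib_left)
qed

text \<open>The expression is the derivative of \<open>(u + r) * (u + s) * (u + t)\<close>, the sum
  of the pairwise products. At a root exactly one factor vanishes, so exactly one of these products
  survives.\<close>

lemma cubic_critical_point: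
  fixes r s t u :: "'a :: field"
  assumes "r \<noteq> s" "r \<noteq> t" "s \<noteq> t" and "(u + r) * (u + s) * (u + t) = 0"
  shows "3 * u ^ 2 + 2 * (r + s + t) * u + (r * s + r * t + s * t) \<noteq> 0"
proof -
  have eq: "3 * u ^ 2 + 2 * (r + s + t) * u + (r * s + r * t + s * t) =
      (u + r) * (u + s) + (u + r) * (u + t) + (u + s) * (u + t)"
    by Groebner_Basis.algebra
  consider "u + r = 0" "u + s \<noteq> 0" "u + t \<noteq> 0" | "u + s = 0" "u + r \<noteq> 0" "u + t \<noteq> 0"
    | "u + t = 0" "u + r \<noteq> 0" "u + s \<noteq> 0"
    using assms by (metis add_left_cancel mult_eq_0_iff)
  then show ?thesis
    unfolding eq by cases simp_all
qed

theorem theorem1p4: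
  fixes a b c h f g :: "'a :: finite_field"
    and T :: "'a \<Rightarrow> complex"
  assumes "odd CHAR('a)"
    and "[CARD('a) = 1] (mod 6)"
    and "T \<in> carrier char_group"
    and "generate char_group {T} = carrier char_group"
    and "a \<noteq> 0" and "b \<noteq> 0" and "c \<noteq> 0"
    and "a \<noteq> b" and "b \<noteq> c" and "a \<noteq> c"
    and "h \<noteq> 0"
    and "3 * h ^ 2 + 2 * ((a * b + b * c + c * a) / (b * c)) * h
          + (a * b + c * a + a ^ 2) / (b * c) = 0"
    and "f = 3 * h + (a * b + b * c + c * a) / (b * c)"
    and "g = h ^ 3 + (a * b + b * c + c * a) / (b * c) * h ^ 2
          + (a * b + c * a + a ^ 2) / (b * c) * h + a ^ 2 / (b * c)"
    and "f \<noteq> 0"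
  shows "phi111 a b c =
    - 1 + of_nat CARD('a) * quadratic_char (b * c) * quadratic_char (- 3 * f) *
      greene_2F1 (T [^]\<^bsub>char_group\<^esub> ((CARD('a) - 1) div 6))
                 (T [^]\<^bsub>char_group\<^esub> (5 * (CARD('a) - 1) div 6))
                 trivial_char
                 (- (3 ^ 3 * g / (2 ^ 2 * f ^ 3)))"
proof -
  have two: "(2 :: 'a) \<noteq> 0"
  proof
    assume "(2 :: 'a) = 0"
    then have "CHAR('a) dvd 2"
      using of_nat_eq_0_iff_char_dvd[where 'a = 'a, of 2] by simp
    then have "CHAR('a) = 1 \<or> CHAR('a) = 2"
      using two_is_prime_nat unfolding prime_nat_iff by blast
    then show False
      using \<open>odd CHAR('a)\<close> by auto
  qed
  have "6 dvd CARD('a) - 1"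
    using \<open>[CARD('a) = 1] (mod 6)\<close> unfolding cong_def by presburger
  then have three: "(3 :: 'a) \<noteq> 0"
    by (intro three_nonzero) (rule dvd_trans[of 3 6], simp_all)
  have four: "(4 :: 'a) \<noteq> 0"
  proof -
    have "(4 :: 'a) = 2 * 2"
      by simp
    then show ?thesis
      using two by (metis mult_eq_0_iff)
  qed
  define r where "r = a / b"
  define s where "s = a / c"
  have rs: "r \<noteq> 1" "s \<noteq> 1" "r \<noteq> s"
    using assms by (auto simp: r_def s_def field_simps)
  have coeffs: "(a * b + b * c + c * a) / (b * c) = 1 + r + s"
    "(a * b + c * a + a ^ 2) / (b * c) = 1 * r + 1 * s + r * s" "a ^ 2 / (b * c) = r * s"
    using assms(5-7) by (simp_all add: r_def s_def field_simps power2_eq_square)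
  have crit: "3 * h ^ 2 + 2 * (1 + r + s) * h + (1 * r + 1 * s + r * s) = 0"
    using assms(12) unfolding coeffs .
  have f: "f = 3 * h + (1 + r + s)"
    using assms(13) unfolding coeffs .
  have g: "g = (h + 1) * (h + r) * (h + s)"
    using assms(14) unfolding coeffs by Groebner_Basis.algebra
  \<comment> \<open>The condition on \<open>h\<close> says that it is a critical point of the cubic,
    so the Taylor expansion there has no linear term; \<open>g\<close> is the value at
    \<open>h\<close> and \<open>f\<close> the coefficient of the square.\<close>
  have shift: "(y + h + 1) * (y + h + r) * (y + h + s) = y ^ 3 + f * y ^ 2 + g" for y
  proof -
    have "(y + h + 1) * (y + h + r) * (y + h + s) = y ^ 3 + f * y ^ 2 + g +
        (3 * h ^ 2 + 2 * (1 + r + s) * h + (1 * r + 1 * s + r * s)) * y"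
      unfolding f g by Groebner_Basis.algebra
    then show ?thesis
      unfolding crit by simp
  qed
  define x where "x = - (3 ^ 3 * g / (2 ^ 2 * f ^ 3))"
  \<comment> \<open>A critical point cannot be one of the three distinct roots.\<close>
  have "g \<noteq> 0"
    using cubic_critical_point[of 1 r s h] crit rs g by auto
  then have x0: "x \<noteq> 0"
    unfolding x_def using three two \<open>f \<noteq> 0\<close>
    by (simp only: neg_equal_0_iff_equal divide_eq_0_iff mult_eq_0_iff power_eq_0_iff) simp
  have x1: "x \<noteq> 1"
  proof
    assume "x = 1"
    then have x: "4 * f ^ 3 + 27 * g = 0"
      using \<open>f \<noteq> 0\<close> four by (simp add: x_def field_simps) (metis add.right_inverse mult.commute)
    \<comment> \<open>\<open>v\<close> is the other critical point of the shifted cubic. The value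
      there, times 27, is \<open>4 * f ^ 3 + 27 * g\<close>, so \<open>x = 1\<close> would make it a
      multiple root.\<close>
    define v where "v = - 2 * f / 3"
    have v: "3 * v = - 2 * f"
      using three by (simp add: v_def)
    have "27 * (v ^ 3 + f * v ^ 2 + g) = (3 * v) ^ 3 + 3 * f * (3 * v) ^ 2 + 27 * g"
      by Groebner_Basis.algebra
    also have "\<dots> = 4 * f ^ 3 + 27 * g"
      unfolding v by Groebner_Basis.algebra
    finally have "27 * (v ^ 3 + f * v ^ 2 + g) = 0"
      using x by simp
    moreover have "(27 :: 'a) = 3 ^ 3"
      by simp
    ultimately have "v ^ 3 + f * v ^ 2 + g = 0"
      using three by (metis mult_eq_0_iff power_eq_0_iff)
    then have root: "(v + h + 1) * (v + h + r) * (v + h + s) = 0"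
      using shift by simp
    have "3 * (v + h) ^ 2 + 2 * (1 + r + s) * (v + h) + (1 * r + 1 * s + r * s) =
        v * (3 * v + 2 * f) + (3 * h ^ 2 + 2 * (1 + r + s) * h + (1 * r + 1 * s + r * s))"
      unfolding f by Groebner_Basis.algebra
    also have "\<dots> = 0"
      unfolding crit v by simp
    finally show False
      using cubic_critical_point[OF _ _ _ root] rs by auto
  qed
  let ?F = "greene_2F1 (T [^]\<^bsub>char_group\<^esub> ((CARD('a) - 1) div 6))
    (T [^]\<^bsub>char_group\<^esub> (5 * (CARD('a) - 1) div 6)) trivial_char x"
  have "(\<Sum>y\<in>UNIV. quadratic_char ((y + 1) * (y + r) * (y + s))) =
      (\<Sum>y\<in>UNIV. quadratic_char (y ^ 3 + f * y ^ 2 + g))"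
    by (rule sum.reindex_bij_witness[of _ "\<lambda>y. y + h" "\<lambda>y. y - h"]) (auto simp flip: shift)
  also have "\<dots> = quadratic_char (3 * f) *
      (\<Sum>w\<in>UNIV. quadratic_char (w ^ 3 - 3 * w + (2 - 4 * x)))"
    unfolding x_def by (rule sum_quadratic_char_depressed[OF two three \<open>f \<noteq> 0\<close>])
  \<comment> \<open>The factor \<open>quadratic_char (- 1)\<close> is inserted twice: one copy turns
    \<open>3 * f\<close> into \<open>- 3 * f\<close>, the other is the sign in front of the cubic
    sum in \<open>greene_2F1_order_six\<close>.\<close>
  also have "\<dots> = quadratic_char (- 1 :: 'a) * quadratic_char (3 * f) *
      (quadratic_char (- 1 :: 'a) * (\<Sum>w\<in>UNIV. quadratic_char (w ^ 3 - 3 * w + (2 - 4 * x))))"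
    using quadratic_char_squared[of "- 1 :: 'a"] by simp
  also have "\<dots> = quadratic_char (- 3 * f) * (of_nat CARD('a) * ?F)"
    unfolding greene_2F1_order_six[OF two assms(2-4) x0 x1]
    by (simp flip: quadratic_char_mult[OF two])
  finally have "(\<Sum>y\<in>UNIV. quadratic_char ((y + 1) * (y + r) * (y + s))) =
      quadratic_char (- 3 * f) * (of_nat CARD('a) * ?F)" .
  then show ?thesis
    unfolding phi111_eq_sum_cubic[OF two assms(5-7)] r_def [symmetric] s_def [symmetric]
      x_def [symmetric] by (simp only: ac_simps)
qed

end
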